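(* Let $L,M$ be logics with languages $\mathscr{L}_L$, $\mathscr{L}_M$ respectively, where $\mathscr{L}_p\subseteq\mathscr{L}_L\subseteq\mathscr{L}_M\subseteq\mathscr{L}_\Box$, such that (i) for every $\varphi\in\mathscr{L}_L$ and every substitution $\sigma:\mathrm{PropVar}\to\mathscr{L}_M$, if $L\vdash\varphi$ then $M\vdash\sigma(\varphi)$; and (ii) $M$ is closed under syllogism: if $M\vdash\varphi\to\psi$ and $M\vdash\psi\to\chi$, then $M\vdash\varphi\to\chi$. If there is a propositionalization $(\sharp,\flat)$ of $M$ into $L$ and $L$ enjoys the uniform Lyndon interpolation property (ULIP), then $M$ also enjoys ULIP.
   Context: Languages. Fix a countably infinite set $\mathrm{PropVar}$ of propositional variables. $\mathscr{L}_p=\{\land,\lor,\to,\bot\}$ and $\mathscr{L}_\Box=\{\land,\lor,\to,\bot,\Box\}$; the same symbols denote the sets of formulas over $\mathrm{PropVar}$. A logic with language $\mathscr{L}$ is identified with its set of theorems, which is closed under renaming of propositional variables; $L\vdash\varphi$ means $\varphi$ is a theorem. Positive and negative variables. $\mathrm{V}^+(p)=\{p\}$, $\mathrm{V}^-(p)=\mathrm{V}^+(\bot)=\mathrm{V}^-(\bot)=\emptyset$; $\mathrm{V}^\bullet(\psi_1\to\psi_2)=\mathrm{V}^\circ(\psi_1)\cup\mathrm{V}^\bullet(\psi_2)$ for $(\bullet,\circ)\in\{(+,-),(-,+)\}$; $\mathrm{V}^\bullet(\psi_1\land\psi_2)=\mathrm{V}^\bullet(\psi_1\lor\psi_2)=\mathrm{V}^\bullet(\psi_1)\cup\mathrm{V}^\bullet(\psi_2)$;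 $\mathrm{V}^\bullet(\Box\psi)=\mathrm{V}^\bullet(\psi)$. ULIP. A logic $L$ with language $\mathscr{L}$ enjoys ULIP if for every $\varphi\in\mathscr{L}$ and all finite sets $P^+,P^-$ of propositional variables there is $\chi\in\mathscr{L}$ such that: (1) $\mathrm{V}^\bullet(\chi)\subseteq\mathrm{V}^\bullet(\varphi)\setminus P^\bullet$ for each $\bullet\in\{+,-\}$; (2) $L\vdash\varphi\to\chi$; (3) $L\vdash\chi\to\psi$ for every $\psi\in\mathscr{L}$ such that $L\vdash\varphi\to\psi$ and $\mathrm{V}^\bullet(\psi)\cap P^\bullet=\emptyset$ for each $\bullet\in\{+,-\}$. Extended language. For each $\varphi\in\mathscr{L}_M$ let $p_\varphi\notin\mathrm{PropVar}$ be a fresh variable (distinct for distinct $\varphi$), and let $\mathrm{PropVar}'=\mathrm{PropVar}\cup\{p_\varphi:\varphi\in\mathscr{L}_M\}$. $\mathscr{L}_L'$ is $\mathscr{L}_L$ with propositional variables extended to $\mathrm{PropVar}'$, and $\mathrm{V}^\bullet$ is extended to $\mathscr{L}_L'$ by the same clauses (values are subsets of $\mathrm{PropVar}'$). $L'$ is the logic obtained from $L$ by replacing its language with $\mathscr{L}_L'$ (that is, $L'\vdash\rho$ iff $L\vdash\rho^*$ for $\rho^*$ obtained from $\rho$ by injectively renaming its variables to elements of $\mathrm{PropVar}$). Standard substitution. $\sigma^{\mathrm{S}}:\mathrm{PropVar}'\to\mathscr{L}_M$ is $\sigma^{\mathrm{S}}(p)=p$ for $p\in\mathrm{PropVar}$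 and $\sigma^{\mathrm{S}}(p_\varphi)=\varphi$; it is extended to formulas of $\mathscr{L}_L'$ in the usual way. Propositionalization. A pair of maps $\sharp,\flat:\mathscr{L}_M\to\mathscr{L}_L'$ (written $\varphi^\sharp,\varphi^\flat$) is a propositionalization of $M$ into $L$ if for all $\varphi,\psi\in\mathscr{L}_M$: (1) $M\vdash\sigma^{\mathrm{S}}(\varphi^\sharp)\to\varphi$ and $M\vdash\varphi\to\sigma^{\mathrm{S}}(\varphi^\flat)$; (2) $M\vdash\varphi\to\psi$ implies $L'\vdash\varphi^\flat\to\psi^\sharp$; (3) for $(\bullet,\circ)\in\{(+,-),(-,+)\}$ and $\natural\in\{\sharp,\flat\}$: (a) $p\in\mathrm{V}^\bullet(\varphi^\natural)\cap\mathrm{PropVar}$ implies $p\in\mathrm{V}^\bullet(\varphi)$; (b) $p_\psi\in\mathrm{V}^\bullet(\varphi^\natural)\setminus\mathrm{PropVar}$ implies $\mathrm{V}^\bullet(\psi)\subseteq\mathrm{V}^+(\varphi)$ and $\mathrm{V}^\circ(\psi)\subseteq\mathrm{V}^-(\varphi)$. *)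

theory Defs
  imports Main "HOL-Library.Countable_Set"
begin

datatype (vars: 'v) fm =
    Var 'v
  | Bot
  | And "'v fm" "'v fm"
  | Or "'v fm" "'v fm"
  | Imp "'v fm" "'v fm"
  | Box "'v fm"
  for map: rename

datatype conn = CAnd | COr | CImp | CBot | CBox

definition lang_p :: "conn set" where
  "lang_p = {CAnd, COr, CImp, CBot}"

definition lang_box :: "conn set" where
  "lang_box = {CAnd, COr, CImp, CBot, CBox}"

primrec conns :: "'v fm \<Rightarrow> conn set" where
  "conns (Var p) = {}"
| "conns Bot = {CBot}"
| "conns (And \<phi> \<psi>) = {CAnd} \<union> conns \<phi> \<union> conns \<psi>"
| "conns (Or \<phi> \<psi>) = {COr} \<union> conns \<phi> \<union> conns \<psi>"
| "conns (Imp \<phi> \<psi>) = {CImp} \<union> conns \<phi> \<union> conns \<psi>"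
| "conns (Box \<phi>) = {CBox} \<union> conns \<phi>"

definition fms :: "conn set \<Rightarrow> 'v fm set" where
  "fms C = {\<phi>. conns \<phi> \<subseteq> C}"

(* PropVar is the whole type 'v.  A renaming of propositional variables is an injective map;
   closure under non-injective variable substitutions is not required. *)
definition is_logic :: "conn set \<Rightarrow> 'v fm set \<Rightarrow> bool" where
  "is_logic C L \<longleftrightarrow> L \<subseteq> fms C \<and> (\<forall>\<phi>\<in>L. \<forall>f :: 'v \<Rightarrow> 'v. inj f \<longrightarrow> rename f \<phi> \<in> L)"

primrec subst :: "('v \<Rightarrow> 'w fm) \<Rightarrow> 'v fm \<Rightarrow> 'w fm" where
  "subst \<sigma> (Var p) = \<sigma> p"
| "subst \<sigma> Bot = Bot"
| "subst \<sigma> (And \<phi> \<psi>) = And (subst \<sigma> \<phi>) (subst \<sigma> \<psi>)"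
| "subst \<sigma> (Or \<phi> \<psi>) = Or (subst \<sigma> \<phi>) (subst \<sigma> \<psi>)"
| "subst \<sigma> (Imp \<phi> \<psi>) = Imp (subst \<sigma> \<phi>) (subst \<sigma> \<psi>)"
| "subst \<sigma> (Box \<phi>) = Box (subst \<sigma> \<phi>)"

datatype sign = Pos | Neg

primrec opp :: "sign \<Rightarrow> sign" where
  "opp Pos = Neg"
| "opp Neg = Pos"

fun V :: "sign \<Rightarrow> 'v fm \<Rightarrow> 'v set" where
  "V Pos (Var p) = {p}"
| "V Neg (Var p) = {}"
| "V b Bot = {}"
| "V b (And \<phi> \<psi>) = V b \<phi> \<union> V b \<psi>"
| "V b (Or \<phi> \<psi>) = V b \<phi> \<union> V b \<psi>"
| "V b (Imp \<phi> \<psi>) = V (opp b) \<phi> \<union> V b \<psi>"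
| "V b (Box \<phi>) = V b \<phi>"

(* P Pos and P Neg are the two finite sets of forbidden variables. *)
definition ULIP :: "conn set \<Rightarrow> 'v fm set \<Rightarrow> bool" where
  "ULIP C L \<longleftrightarrow>
     (\<forall>\<phi>\<in>fms C. \<forall>P :: sign \<Rightarrow> 'v set. (\<forall>b. finite (P b)) \<longrightarrow>
       (\<exists>\<chi>\<in>fms C.
          (\<forall>b. V b \<chi> \<subseteq> V b \<phi> - P b) \<and>
          Imp \<phi> \<chi> \<in> L \<and>
          (\<forall>\<psi>\<in>fms C. Imp \<phi> \<psi> \<in> L \<and> (\<forall>b. V b \<psi> \<inter> P b = {}) \<longrightarrow> Imp \<chi> \<psi> \<in> L)))"

datatype 'v pvar = Old 'v | Fresh "'v fm"

(* Only the fresh variables of formulas over CM belong to PropVar'; the type 'v pvar also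
   contains Fresh of formulas outside that language. *)
definition propvar' :: "conn set \<Rightarrow> 'v pvar set" where
  "propvar' CM = range Old \<union> Fresh ` fms CM"

definition fms' :: "conn set \<Rightarrow> conn set \<Rightarrow> 'v pvar fm set" where
  "fms' CM CL = {\<rho> \<in> fms CL. vars \<rho> \<subseteq> propvar' CM}"

(* L'.  For infinite 'v an injective renaming of the finitely many variables of a formula
   always exists, and since L is closed under injective renaming the choice is immaterial. *)
definition ext_logic :: "conn set \<Rightarrow> conn set \<Rightarrow> 'v fm set \<Rightarrow> 'v pvar fm set" where
  "ext_logic CM CL L =
     {\<rho> \<in> fms' CM CL. \<exists>f :: 'v pvar \<Rightarrow> 'v. inj_on f (vars \<rho>) \<and> rename f \<rho> \<in> L}"

primrec std_subst :: "'v pvar \<Rightarrow> 'v fm" where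
  "std_subst (Old p) = Var p"
| "std_subst (Fresh \<phi>) = \<phi>"

definition propositionalization ::
  "conn set \<Rightarrow> 'v fm set \<Rightarrow> conn set \<Rightarrow> 'v fm set \<Rightarrow>
     ('v fm \<Rightarrow> 'v pvar fm) \<Rightarrow> ('v fm \<Rightarrow> 'v pvar fm) \<Rightarrow> bool" where
  "propositionalization CM M CL L sharp flat \<longleftrightarrow>
     (\<forall>\<phi>\<in>fms CM. sharp \<phi> \<in> fms' CM CL \<and> flat \<phi> \<in> fms' CM CL) \<and>
     (\<forall>\<phi>\<in>fms CM. Imp (subst std_subst (sharp \<phi>)) \<phi> \<in> M \<and>
                  Imp \<phi> (subst std_subst (flat \<phi>)) \<in> M) \<and>
     (\<forall>\<phi>\<in>fms CM. \<forall>\<psi>\<in>fms CM.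
        Imp \<phi> \<psi> \<in> M \<longrightarrow> Imp (flat \<phi>) (sharp \<psi>) \<in> ext_logic CM CL L) \<and>
     (\<forall>\<phi>\<in>fms CM. \<forall>b. \<forall>h\<in>{sharp, flat}.
        (\<forall>p. Old p \<in> V b (h \<phi>) \<longrightarrow> p \<in> V b \<phi>) \<and>
        (\<forall>\<psi>. Fresh \<psi> \<in> V b (h \<phi>) \<longrightarrow> V b \<psi> \<subseteq> V Pos \<phi> \<and> V (opp b) \<psi> \<subseteq> V Neg \<phi>))"

end

(* Given phi and P, interpolate the flat translation of phi in L', forbidding besides P also
   those fresh variables p_psi whose standard instance would bring in a forbidden variable with
   the wrong sign; only the finitely many p_psi occurring in flat phi matter, so this set is
   finite. The standard substitution of that interpolant is an interpolant for M.
   ULIP passes from L to L' along one injection of all of PropVar' into PropVar. *)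
theory Submission
  imports Defs "HOL-Library.Countable"
begin

section \<open>Countability of formulas and extended variables\<close>

instance fm :: (countable) countable
  by countable_datatype

instance pvar :: (countable) countable
  by countable_datatype

section \<open>Signed variables under renaming and substitution\<close>

lemma opp_opp [simp]: "opp (opp b) = b"
  by (cases b) auto

lemma V_rename: "V b (rename f \<phi>) = f ` V b \<phi>"
proof (induction \<phi> arbitrary: b)
  case (Var p)
  then show ?case by (cases b) auto
qed auto

lemma vars_eq_V: "vars \<phi> = V b \<phi> \<union> V (opp b) \<phi>"
proof (induction \<phi> arbitrary: b)
  case (Var p)
  then show ?case by (cases b) auto
next
  case (Imp \<phi> \<psi>)
  show ?case
    unfolding fm.set V.simps opp_opp Imp.IH(1)[of b] Imp.IH(2)[of b] by blast
next
  case (And \<phi> \<psi>)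
  show ?case
    unfolding fm.set V.simps And.IH(1)[of b] And.IH(2)[of b] by blast
next
  case (Or \<phi> \<psi>)
  show ?case
    unfolding fm.set V.simps Or.IH(1)[of b] Or.IH(2)[of b] by blast
qed simp_all

lemma finite_vars: "finite (vars \<phi>)"
  by (induction \<phi>) auto

lemma V_subset_vars: "V b \<phi> \<subseteq> vars \<phi>"
  unfolding vars_eq_V[of \<phi> b] by (rule Un_upper1)

lemma finite_V: "finite (V b \<phi>)"
  using V_subset_vars finite_vars by (rule finite_subset)

lemma vars_subset_if_V_subset: "(\<And>b. V b \<phi> \<subseteq> V b \<psi>) \<Longrightarrow> vars \<phi> \<subseteq> vars \<psi>"
  unfolding vars_eq_V[of _ Pos] by (intro Un_mono)

text \<open>Signs multiply: a positive occurrence keeps the signs of the formula put in its place, a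
  negative one reverses them.\<close>

lemma V_subst:
  "V b (subst \<sigma> \<phi>) = (\<Union>p\<in>V Pos \<phi>. V b (\<sigma> p)) \<union> (\<Union>p\<in>V Neg \<phi>. V (opp b) (\<sigma> p))"
proof (induction \<phi> arbitrary: b)
  case (Imp \<phi> \<psi>)
  then show ?case by (auto simp: Un_ac)
qed auto

section \<open>Languages under renaming and substitution\<close>

lemma conns_rename [simp]: "conns (rename f \<phi>) = conns \<phi>"
  by (induction \<phi>) auto

lemma rename_in_fms_iff [simp]: "rename f \<phi> \<in> fms C \<longleftrightarrow> \<phi> \<in> fms C"
  by (simp add: fms_def)

lemma subst_in_fms:
  assumes "\<phi> \<in> fms C" and "\<And>p. p \<in> vars \<phi> \<Longrightarrow> \<sigma> p \<in> fms C"
  shows "subst \<sigma> \<phi> \<in> fms C"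
  using assms by (induction \<phi>) (auto simp: fms_def)

lemma subst_rename: "subst \<sigma> (rename f \<phi>) = subst (\<sigma> \<circ> f) \<phi>"
  by (induction \<phi>) auto

lemma subst_cong: "(\<And>p. p \<in> vars \<phi> \<Longrightarrow> \<sigma> p = \<tau> p) \<Longrightarrow> subst \<sigma> \<phi> = subst \<tau> \<phi>"
  by (induction \<phi>) auto

lemma fms_mono: "C \<subseteq> D \<Longrightarrow> fms C \<subseteq> fms D"
  by (auto simp: fms_def)

text \<open>The variable bound in \<open>fms'\<close> is what excludes \<open>Fresh \<theta>\<close>
  for \<open>\<theta>\<close> outside the language of \<open>M\<close>.\<close>

lemma std_subst_var_in_fms: "\<rho> \<in> fms' CM CL \<Longrightarrow> x \<in> vars \<rho> \<Longrightarrow> std_subst x \<in> fms CM"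
  by (cases x) (auto simp: fms'_def propvar'_def fms_def)

lemma Imp_in_fms'_iff: "CImp \<in> CL \<Longrightarrow> Imp \<rho> \<tau> \<in> fms' CM CL \<longleftrightarrow> \<rho> \<in> fms' CM CL \<and> \<tau> \<in> fms' CM CL"
  by (auto simp: fms'_def fms_def)

section \<open>Injective renamings and the extended logic\<close>

lemma ex_inj_pvar:
  assumes "countable (UNIV :: 'v set)" and "infinite (UNIV :: 'v set)"
  shows "\<exists>f :: 'v pvar \<Rightarrow> 'v. inj f"
proof -
  let ?e = "to_nat_on (UNIV :: 'v set)" and ?d = "from_nat_into (UNIV :: 'v set)"
  have "inj ?e"
    using assms(1) by (rule inj_on_to_nat_on)
  moreover have "inj ?d"
    using bij_betw_from_nat_into[OF assms] by (rule bij_betw_imp_inj_on)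
  \<comment> \<open>Countability of \<open>'v\<close> is a set assumption, not a class constraint,
    so variables are first coded by naturals; \<open>to_nat\<close> then acts on
    \<open>nat pvar\<close>.\<close>
  ultimately have "inj (?d \<circ> to_nat \<circ> map_pvar ?e)"
    by (intro inj_compose pvar.inj_map) simp_all
  then show ?thesis by blast
qed

text \<open>The map sending \<open>g x\<close> to \<open>f x\<close> is a bijection between finite
  sets. Their complements are countably infinite, so an enumeration of each matches them up and
  completes it to a permutation of \<open>'v\<close>.\<close>

lemma ex_inj_extending:
  fixes f g :: "'a \<Rightarrow> 'v"
  assumes "countable (UNIV :: 'v set)" and "infinite (UNIV :: 'v set)"
    and "finite A" and "inj_on g A" and "inj_on f A"
  shows "\<exists>h :: 'v \<Rightarrow> 'v. inj h \<and> (\<forall>x\<in>A. h (g x) = f x)"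
proof -
  have compl: "countable (- (k ` A))" "infinite (- (k ` A))" for k :: "'a \<Rightarrow> 'v"
    using assms(1-3) countable_subset[OF subset_UNIV]
    by (auto simp: finite_compl)
  define h\<^sub>0 where "h\<^sub>0 = from_nat_into (- (f ` A)) \<circ> to_nat_on (- (g ` A))"
  have "bij_betw h\<^sub>0 (- (g ` A)) (- (f ` A))"
    unfolding h\<^sub>0_def
    using to_nat_on_infinite[OF compl] bij_betw_from_nat_into[OF compl] by (rule bij_betw_trans)
  moreover have "bij_betw (f \<circ> inv_into A g) (g ` A) (f ` A)"
    using assms(4,5) by (intro bij_betw_trans[of _ _ A] bij_betw_inv_into)
      (auto intro: inj_on_imp_bij_betw)
  ultimately have "bij_betw (\<lambda>y. if y \<in> g ` A then (f \<circ> inv_into A g) y else h\<^sub>0 y)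
      (g ` A \<union> - (g ` A)) (f ` A \<union> - (f ` A))"
    by (intro bij_betw_disjoint_Un) (auto simp del: o_apply)
  then have "inj (\<lambda>y. if y \<in> g ` A then (f \<circ> inv_into A g) y else h\<^sub>0 y)"
    by (simp add: bij_betw_def)
  moreover have "\<forall>x\<in>A. (\<lambda>y. if y \<in> g ` A then (f \<circ> inv_into A g) y else h\<^sub>0 y) (g x) = f x"
    using assms(4) by simp
  ultimately show ?thesis by blast
qed

text \<open>On the finitely many variables of \<open>\<rho>\<close>, any witness \<open>g\<close>
  becomes \<open>f\<close> after an injective renaming of \<open>'v\<close>, under which
  \<open>L\<close> is closed. One fixed \<open>f\<close> thus serves all formulas at once.\<close>

lemma in_ext_logic_iff:
  fixes f :: "'v pvar \<Rightarrow> 'v"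
  assumes "countable (UNIV :: 'v set)" and "infinite (UNIV :: 'v set)"
    and "is_logic CL L" and "inj f"
  shows "\<rho> \<in> ext_logic CM CL L \<longleftrightarrow> \<rho> \<in> fms' CM CL \<and> rename f \<rho> \<in> L"
proof
  assume "\<rho> \<in> ext_logic CM CL L"
  then obtain g :: "'v pvar \<Rightarrow> 'v"
    where \<rho>: "\<rho> \<in> fms' CM CL" and g: "inj_on g (vars \<rho>)" "rename g \<rho> \<in> L"
    by (auto simp: ext_logic_def)
  obtain h where h: "inj h" "\<forall>x\<in>vars \<rho>. h (g x) = f x"
    using ex_inj_extending[OF assms(1,2) finite_vars g(1)] assms(4) inj_on_subset by blast
  have "rename h (rename g \<rho>) \<in> L"
    using assms(3) g(2) h(1) by (auto simp: is_logic_def)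
  also have "rename h (rename g \<rho>) = rename f \<rho>"
    using h(2) by (auto simp: fm.map_comp intro: fm.map_cong)
  finally show "\<rho> \<in> fms' CM CL \<and> rename f \<rho> \<in> L"
    using \<rho> by simp
next
  assume "\<rho> \<in> fms' CM CL \<and> rename f \<rho> \<in> L"
  then show "\<rho> \<in> ext_logic CM CL L"
    using assms(4) inj_on_subset unfolding ext_logic_def by blast
qed

text \<open>The \<open>f\<close>-image of the problem is solved in \<open>L\<close> and the
  interpolant is pulled back along \<open>inv f\<close>.\<close>

lemma ULIP_ext_logic:
  fixes L :: "'v fm set"
  assumes v: "countable (UNIV :: 'v set)" "infinite (UNIV :: 'v set)"
    and "CImp \<in> CL" and "is_logic CL L" and "ULIP CL L"
    and \<rho>: "\<rho> \<in> fms' CM CL" and "\<And>b. finite (Q b)"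
  obtains \<chi> where "\<chi> \<in> fms' CM CL" and "\<And>b. V b \<chi> \<subseteq> V b \<rho> - Q b"
    and "Imp \<rho> \<chi> \<in> ext_logic CM CL L"
    and "\<And>\<tau>. Imp \<rho> \<tau> \<in> ext_logic CM CL L \<Longrightarrow> (\<And>b. V b \<tau> \<inter> Q b = {})
           \<Longrightarrow> Imp \<chi> \<tau> \<in> ext_logic CM CL L"
proof -
  obtain f :: "'v pvar \<Rightarrow> 'v" where f: "inj f"
    using ex_inj_pvar[OF v] by blast
  note ext_iff = in_ext_logic_iff[OF v assms(4) f] Imp_in_fms'_iff[OF assms(3)]
  have "rename f \<rho> \<in> fms CL"
    using \<rho> by (simp add: fms'_def)
  then obtain \<chi>' where \<chi>': "\<chi>' \<in> fms CL"
    and V\<chi>': "\<And>b. V b \<chi>' \<subseteq> V b (rename f \<rho>) - f ` Q b"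
    and L: "Imp (rename f \<rho>) \<chi>' \<in> L"
      "\<And>\<psi>. \<psi> \<in> fms CL \<Longrightarrow> Imp (rename f \<rho>) \<psi> \<in> L \<Longrightarrow> (\<And>b. V b \<psi> \<inter> f ` Q b = {})
        \<Longrightarrow> Imp \<chi>' \<psi> \<in> L"
    using assms(5)[unfolded ULIP_def, rule_format, of "rename f \<rho>" "\<lambda>b. f ` Q b"] assms(7)
    by auto
  define \<chi> where "\<chi> = rename (inv f) \<chi>'"
  \<comment> \<open>The signed variable bounds keep \<open>\<chi>'\<close> inside the range of
    \<open>f\<close>, where \<open>inv f\<close> is a two-sided inverse.\<close>
  have "vars \<chi>' \<subseteq> vars (rename f \<rho>)"
    using V\<chi>' by (intro vars_subset_if_V_subset) blast
  then have "f (inv f x) = x" if "x \<in> vars \<chi>'" for x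
    using that by (auto simp: fm.set_map f_inv_into_f)
  then have ren: "rename f \<chi> = \<chi>'"
    unfolding \<chi>_def fm.map_comp by (auto intro: trans[OF fm.map_cong0 fm.map_ident])
  have "f ` V b \<chi> \<subseteq> f ` (V b \<rho> - Q b)" for b
    using V\<chi>'[of b] f unfolding ren[symmetric] V_rename by (simp add: image_set_diff)
  then have V\<chi>: "V b \<chi> \<subseteq> V b \<rho> - Q b" for b
    using f by (simp add: inj_image_subset_iff)
  have \<chi>: "\<chi> \<in> fms' CM CL"
    using \<rho> \<chi>' vars_subset_if_V_subset[of \<chi> \<rho>] V\<chi> unfolding fms'_def \<chi>_def by fastforce
  show thesis
  proof (rule that[OF \<chi> V\<chi>])
    show "Imp \<rho> \<chi> \<in> ext_logic CM CL L"
      using \<rho> \<chi> L(1) by (simp add: ext_iff ren)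
    fix \<tau> assume \<tau>: "Imp \<rho> \<tau> \<in> ext_logic CM CL L" "\<And>b. V b \<tau> \<inter> Q b = {}"
    have \<tau>_fms: "\<tau> \<in> fms CL"
      using \<tau>(1) by (simp add: ext_iff) (simp add: fms'_def)
    have "V b (rename f \<tau>) \<inter> f ` Q b = {}" for b
      using \<tau>(2)[of b] f by (simp add: V_rename flip: image_Int)
    then have "Imp \<chi>' (rename f \<tau>) \<in> L"
      using \<tau>(1) by (intro L(2)) (auto simp: ext_iff \<tau>_fms)
    then show "Imp \<chi> \<tau> \<in> ext_logic CM CL L"
      using \<tau>(1) \<chi> by (simp add: ext_iff ren)
  qed
qed

section \<open>Standard substitution into \<open>M\<close>\<close>

lemma std_subst_in_fms:
  assumes "CL \<subseteq> CM" and "\<rho> \<in> fms' CM CL"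
  shows "subst std_subst \<rho> \<in> fms CM"
proof (rule subst_in_fms)
  show "\<rho> \<in> fms CM"
    using assms fms_mono by (auto simp: fms'_def)
  show "std_subst x \<in> fms CM" if "x \<in> vars \<rho>" for x
    using assms(2) that by (rule std_subst_var_in_fms)
qed

text \<open>The standard substitution factors through the renaming that witnesses membership, so the
  substitution hypothesis on \<open>L\<close> and \<open>M\<close> applies to the renamed
  formula.\<close>

lemma std_subst_ext_logic:
  fixes L M :: "'v fm set"
  assumes "\<And>\<phi> \<sigma>. \<phi> \<in> fms CL \<Longrightarrow> (\<And>p :: 'v. \<sigma> p \<in> fms CM) \<Longrightarrow> \<phi> \<in> L \<Longrightarrow> subst \<sigma> \<phi> \<in> M"
    and "\<rho> \<in> ext_logic CM CL L"
  shows "subst std_subst \<rho> \<in> M"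
proof -
  obtain f :: "'v pvar \<Rightarrow> 'v"
    where \<rho>: "\<rho> \<in> fms' CM CL" and f: "inj_on f (vars \<rho>)" "rename f \<rho> \<in> L"
    using assms(2) by (auto simp: ext_logic_def)
  \<comment> \<open>Off the image of the renaming any value in \<open>fms CM\<close> would do;
    \<open>Var p\<close> lies in every language.\<close>
  define \<sigma> where
    "\<sigma> p = (if p \<in> f ` vars \<rho> then std_subst (inv_into (vars \<rho>) f p) else Var p)" for p
  have "\<sigma> p \<in> fms CM" for p
    using std_subst_var_in_fms[OF \<rho>] by (auto simp: \<sigma>_def f(1)) (simp add: fms_def)
  then have "subst \<sigma> (rename f \<rho>) \<in> M"
    using \<rho> f(2) by (intro assms(1)) (auto simp: fms'_def)
  also have "subst \<sigma> (rename f \<rho>) = subst std_subst \<rho>"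
    unfolding subst_rename using f(1) by (intro subst_cong) (simp add: \<sigma>_def)
  finally show ?thesis .
qed

section \<open>Uniform Lyndon interpolation for \<open>M\<close>\<close>

theorem theorem4p4:
  fixes CL CM :: "conn set" and L M :: "'v fm set"
  assumes "countable (UNIV :: 'v set)" and "infinite (UNIV :: 'v set)"
    and "lang_p \<subseteq> CL" and "CL \<subseteq> CM" and "CM \<subseteq> lang_box"
    and "is_logic CL L" and "is_logic CM M"
    and "\<And>\<phi> \<sigma>. \<phi> \<in> fms CL \<Longrightarrow> (\<And>p :: 'v. \<sigma> p \<in> fms CM) \<Longrightarrow> \<phi> \<in> L \<Longrightarrow> subst \<sigma> \<phi> \<in> M"
    and "\<And>\<phi> \<psi> \<chi>. Imp \<phi> \<psi> \<in> M \<Longrightarrow> Imp \<psi> \<chi> \<in> M \<Longrightarrow> Imp \<phi> \<chi> \<in> M"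
    and "\<exists>sharp flat. propositionalization CM M CL L sharp flat"
    and "ULIP CL L"
  shows "ULIP CM M"
  unfolding ULIP_def
proof (intro ballI allI impI)
  fix \<phi> :: "'v fm" and P :: "sign \<Rightarrow> 'v set"
  assume \<phi>: "\<phi> \<in> fms CM" and P: "\<forall>b. finite (P b)"
  obtain sharp flat where propn: "propositionalization CM M CL L sharp flat"
    using assms(10) by blast
  have CImp: "CImp \<in> CL"
    using assms(3) by (auto simp: lang_p_def)
  have lang: "flat \<phi> \<in> fms' CM CL"
    using propn \<phi> by (simp add: propositionalization_def)
  have from_sharp: "Imp (subst std_subst (sharp \<psi>)) \<psi> \<in> M"
    and to_flat: "Imp \<psi> (subst std_subst (flat \<psi>)) \<in> M" if "\<psi> \<in> fms CM" for \<psi>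
    using propn that by (simp_all add: propositionalization_def)
  have flat_sharp: "Imp (flat \<phi>) (sharp \<psi>) \<in> ext_logic CM CL L"
    if "\<psi> \<in> fms CM" "Imp \<phi> \<psi> \<in> M" for \<psi>
    using propn \<phi> that by (simp add: propositionalization_def)
  have V_Old: "p \<in> V b \<psi>"
    if "\<psi> \<in> fms CM" "h \<in> {sharp, flat}" "Old p \<in> V b (h \<psi>)" for p \<psi> b h
    using propn that unfolding propositionalization_def by blast
  have V_Fresh: "V b \<theta> \<subseteq> V Pos \<psi>" "V (opp b) \<theta> \<subseteq> V Neg \<psi>"
    if "\<psi> \<in> fms CM" "h \<in> {sharp, flat}" "Fresh \<theta> \<in> V b (h \<psi>)" for \<theta> \<psi> b h
    using propn that unfolding propositionalization_def by blast+
  \<comment> \<open>By \<open>V_subst\<close>, an occurrence of sign \<open>b\<close> contributes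
    \<open>V b \<theta>\<close> to the positive variables and \<open>V (opp b) \<theta>\<close> to
    the negative ones, whichever sign \<open>b\<close> is.\<close>
  define bad where "bad b = {Fresh \<theta> | \<theta>. V b \<theta> \<inter> P Pos \<noteq> {} \<or> V (opp b) \<theta> \<inter> P Neg \<noteq> {}}"
    for b
  define Q where "Q b = Old ` P b \<union> (V b (flat \<phi>) \<inter> bad b)" for b
  have "finite (Q b)" for b
    using P by (simp add: Q_def finite_V)
  then obtain \<chi> where \<chi>: "\<chi> \<in> fms' CM CL" "\<And>b. V b \<chi> \<subseteq> V b (flat \<phi>) - Q b"
    "Imp (flat \<phi>) \<chi> \<in> ext_logic CM CL L"
    "\<And>\<tau>. Imp (flat \<phi>) \<tau> \<in> ext_logic CM CL L \<Longrightarrow> (\<And>b. V b \<tau> \<inter> Q b = {})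
       \<Longrightarrow> Imp \<chi> \<tau> \<in> ext_logic CM CL L"
    using ULIP_ext_logic[OF assms(1,2) CImp assms(6,11) lang] by metis
  have ext_M: "subst std_subst \<rho> \<in> M" if "\<rho> \<in> ext_logic CM CL L" for \<rho>
    using assms(8) that by (rule std_subst_ext_logic)
  show "\<exists>\<chi>\<in>fms CM. (\<forall>b. V b \<chi> \<subseteq> V b \<phi> - P b) \<and> Imp \<phi> \<chi> \<in> M \<and>
    (\<forall>\<psi>\<in>fms CM. Imp \<phi> \<psi> \<in> M \<and> (\<forall>b. V b \<psi> \<inter> P b = {}) \<longrightarrow> Imp \<chi> \<psi> \<in> M)"
  proof (intro bexI[of _ "subst std_subst \<chi>"] conjI allI ballI impI)
    show "subst std_subst \<chi> \<in> fms CM"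
      using assms(4) \<chi>(1) by (rule std_subst_in_fms)
    \<comment> \<open>Taken at both values of \<open>b\<close>, these inclusions bound both unions
      of \<open>V_subst\<close> for either sign of the result.\<close>
    have V_std: "V b (std_subst x) \<subseteq> V Pos \<phi> - P Pos" "V (opp b) (std_subst x) \<subseteq> V Neg \<phi> - P Neg"
      if "x \<in> V b \<chi>" for b x
    proof -
      have x: "x \<in> V b (flat \<phi>)" "x \<notin> Q b"
        using \<chi>(2) that by blast+
      have "V b (std_subst x) \<subseteq> V Pos \<phi> - P Pos \<and> V (opp b) (std_subst x) \<subseteq> V Neg \<phi> - P Neg"
      proof (cases x)
        case (Old p)
        then have "p \<in> V b \<phi> - P b"
          using x V_Old[OF \<phi>, of flat] by (auto simp: Q_def)
        with Old show ?thesis by (cases b) auto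
      next
        case (Fresh \<theta>)
        \<comment> \<open>As \<open>x\<close> lies in \<open>V b (flat \<phi>)\<close>, avoiding
          \<open>Q b\<close> means avoiding \<open>bad b\<close>: cutting \<open>bad b\<close> down
          to a finite set lost nothing.\<close>
        then have "V b \<theta> \<inter> P Pos = {}" "V (opp b) \<theta> \<inter> P Neg = {}"
          using x by (auto simp: Q_def bad_def)
        with Fresh show ?thesis
          using x(1) V_Fresh[OF \<phi>, of flat \<theta> b] by auto
      qed
      then show "V b (std_subst x) \<subseteq> V Pos \<phi> - P Pos"
        "V (opp b) (std_subst x) \<subseteq> V Neg \<phi> - P Neg" by auto
    qed
    show "V b (subst std_subst \<chi>) \<subseteq> V b \<phi> - P b" for b
      using V_std[of _ Pos] V_std[of _ Neg] unfolding V_subst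
      by (cases b; simp only: opp.simps) blast+
    show "Imp \<phi> (subst std_subst \<chi>) \<in> M"
      using assms(9) to_flat[OF \<phi>] ext_M[OF \<chi>(3)] by simp
    fix \<psi> assume \<psi>: "\<psi> \<in> fms CM" "Imp \<phi> \<psi> \<in> M \<and> (\<forall>b. V b \<psi> \<inter> P b = {})"
    \<comment> \<open>The sign conditions on \<open>sharp\<close> carry the disjointness of
      \<open>\<psi>\<close> from \<open>P\<close> over to \<open>Q\<close>, which makes
      \<open>sharp \<psi>\<close> an admissible consequence of \<open>flat \<phi>\<close>.\<close>
    have "x \<notin> Q b" if x: "x \<in> V b (sharp \<psi>)" for b x
    proof (cases x)
      case (Old p)
      then show ?thesis
        using x V_Old[OF \<psi>(1), of sharp] \<psi>(2) by (auto simp: Q_def bad_def)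
    next
      case (Fresh \<theta>)
      then have "V b \<theta> \<inter> P Pos = {}" "V (opp b) \<theta> \<inter> P Neg = {}"
        using x V_Fresh[OF \<psi>(1), of sharp \<theta> b] \<psi>(2) by blast+
      with Fresh show ?thesis by (auto simp: Q_def bad_def)
    qed
    then have "Imp \<chi> (sharp \<psi>) \<in> ext_logic CM CL L"
      using flat_sharp \<psi> by (intro \<chi>(4)) auto
    \<comment> \<open>Syllogism through the standard instance of
      \<open>sharp \<psi>\<close>.\<close>
    then show "Imp (subst std_subst \<chi>) \<psi> \<in> M"
      using assms(9) from_sharp[OF \<psi>(1)] ext_M[of "Imp \<chi> (sharp \<psi>)"] by simp
  qed
qed

end
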